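(* Let $u$ be a fuzzy set on $\mathbb{R}^m$, i.e. an arbitrary function $u:\mathbb{R}^m\to[0,1]$. Then the set $$D(u)=\{\alpha\in(0,1): [u]_\alpha\nsubseteq\overline{\{u>\alpha\}}\}$$ is at most countable.
   Context: For a function $u:\mathbb{R}^m\to[0,1]$ and $\alpha\in(0,1]$, the $\alpha$-cut of $u$ is $[u]_\alpha=\{x\in\mathbb{R}^m: u(x)\ge\alpha\}$. The strong $\alpha$-cut of $u$ is $\{u>\alpha\}=\{x\in\mathbb{R}^m: u(x)>\alpha\}$. The bar denotes topological closure in $\mathbb{R}^m$ with its usual Euclidean topology. *)

theory Defs
  imports "HOL-Analysis.Analysis"
begin

definition fuzzy_set :: "(real ^ 'm \<Rightarrow> real) \<Rightarrow> bool" where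
  "fuzzy_set u \<longleftrightarrow> (\<forall>x. u x \<in> {0..1})"

(* The alpha-cut is meant for 0 < alpha <= 1; in particular the value at alpha = 0
   is not the closure of the support. *)
definition alpha_cut :: "(real ^ 'm \<Rightarrow> real) \<Rightarrow> real \<Rightarrow> (real ^ 'm) set" where
  "alpha_cut u \<alpha> = {x. u x \<ge> \<alpha>}"

definition strong_alpha_cut :: "(real ^ 'm \<Rightarrow> real) \<Rightarrow> real \<Rightarrow> (real ^ 'm) set" where
  "strong_alpha_cut u \<alpha> = {x. u x > \<alpha>}"

definition D :: "(real ^ 'm \<Rightarrow> real) \<Rightarrow> real set" where
  "D u = {\<alpha> \<in> {0<..<1}. \<not> alpha_cut u \<alpha> \<subseteq> closure (strong_alpha_cut u \<alpha>)}"

end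

theory Submission
  imports Defs
begin

text \<open>If \<alpha> is exceptional, some \<open>x\<close> with \<open>u x\<close> \<ge> \<alpha>
  has a basic neighbourhood \<open>B\<close> that misses {u > \<alpha>}. Then \<open>u\<close> is at
  most \<alpha> on \<open>B\<close> and equals \<alpha> at \<open>x\<close>, so \<open>B\<close>
  alone determines \<alpha>, and there are only countably many \<open>B\<close>.\<close>

text \<open>Each exceptional level is the maximum of \<open>u\<close> on some set of a countable base of the topology.\<close>

lemma countable_not_subset_closure_greater:
  fixes u :: "'a::second_countable_topology \<Rightarrow> 'b::conditionally_complete_linorder"
  shows "countable {\<alpha>. \<not> {x. \<alpha> \<le> u x} \<subseteq> closure {x. \<alpha> < u x}}"
proof -
  obtain \<B> :: "'a set set" where "countable \<B>" and basis: "topological_basis \<B>"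
    using ex_countable_basis by blast
  \<comment> \<open>\<open>Sup\<close> makes the map total on the base; its value is irrelevant for
    those \<open>B\<close> on which \<open>u\<close> is unbounded or attains no maximum.\<close>
  have "\<alpha> \<in> (\<lambda>B. Sup (u ` B)) ` \<B>"
    if nsub: "\<not> {x. \<alpha> \<le> u x} \<subseteq> closure {x. \<alpha> < u x}" for \<alpha>
  proof -
    from nsub obtain x where x: "\<alpha> \<le> u x" "x \<notin> closure {x. \<alpha> < u x}"
      by blast
    then obtain B where B: "B \<in> \<B>" "x \<in> B" "B \<subseteq> - closure {x. \<alpha> < u x}"
      using topological_basisE[OF basis, of "- closure {x. \<alpha> < u x}" x] by auto
    have le: "u y \<le> \<alpha>" if "y \<in> B" for y
      using that B(3) closure_subset[of "{x. \<alpha> < u x}"] by (force simp: not_less[symmetric])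
    then have "u x = \<alpha>"
      using B(2) x(1) by (simp add: antisym)
    \<comment> \<open>The bound \<alpha> is attained at \<open>x\<close>, so this \<open>Sup\<close>
      is a genuine maximum.\<close>
    then have "Sup (u ` B) = \<alpha>"
      using B(2) le by (intro cSup_eq_maximum) auto
    then show ?thesis
      using B(1) by blast
  qed
  then show ?thesis
    using \<open>countable \<B>\<close> by (blast intro: countable_subset countable_image)
qed

theorem theorem3p2:
  fixes u :: "real ^ 'm \<Rightarrow> real"
  assumes "fuzzy_set u"
  shows "countable (D u)"
  by (rule countable_subset[OF _ countable_not_subset_closure_greater[of u]])
    (auto simp: D_def alpha_cut_def strong_alpha_cut_def)

end
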